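(* There exists a constant $C_T>0$ such that for all $f\in C([-1,1])$, the following holds: $$\omega_\phi\left(f;\frac1N\right)\le\frac{C_T}{n}\sum_{\substack{k=3\\ k\text{ odd}}}^{N}E(f;\mathcal{H}_k),$$ where $\phi(x)=\sqrt{1-x^2}$ and $N=2n+1$.
   Context: Fix $T>1$; $n$ is a positive integer, so $N=2n+1$ is odd. For each odd positive integer $k=2m+1$ let $\mathcal{H}_k=\mathrm{span}\{e^{\frac{i\pi}{T}jx}\}_{j=-m}^{m}\subset C([-1,1])$. For $f\in C([-1,1])$, the best approximation error is $E(f;\mathcal{H}_k)=\inf_{r\in\mathcal{H}_k}\|f-r\|_{L^\infty(-1,1)}$. The weighted modulus of continuity of $f\in C([-1,1])$ with weight $\phi:[-1,1]\to[0,\infty)$ is $$\omega_\phi(f;\delta)=\sup_{\substack{x\pm h\in[-1,1]\\ 0\le h<\phi(x)\delta}}|f(x+h)-f(x-h)|.$$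
   Formalization: The sum is taken over odd k from 1 to N rather than from 3 to N, adding the term E(f;H_1), because the printed inequality fails for f(x)=exp(iπx/T), which lies in H_3 and makes the right side zero while the modulus is positive. *)

theory Defs
  imports "HOL-Probability.Essential_Supremum" "HOL-Analysis.Analysis"
begin

text \<open>Elements of \<open>C([-1,1])\<close> are functions \<open>f :: real \<Rightarrow> complex\<close> with
  \<open>continuous_on {-1..1} f\<close>; values outside \<open>[-1,1]\<close> are never used.\<close>

definition weighted_modulus ::
  "(real \<Rightarrow> real) \<Rightarrow> (real \<Rightarrow> complex) \<Rightarrow> real \<Rightarrow> real"
where
  "weighted_modulus \<phi> f \<delta> =
     Sup {cmod (f (x + h) - f (x - h)) | x h.
            x + h \<in> {-1..1} \<and> x - h \<in> {-1..1} \<and> 0 \<le> h \<and> h < \<phi> x * \<delta>}"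

text \<open>\<open>\<H>\<^sub>k\<close> for odd \<open>k = 2m + 1\<close>, so that \<open>(k - 1) div 2 = m\<close>; only used for odd \<open>k\<close>.\<close>

definition trig_space :: "real \<Rightarrow> nat \<Rightarrow> (real \<Rightarrow> complex) set"
where
  "trig_space T k =
     {r. \<exists>c :: int \<Rightarrow> complex. \<forall>x.
        r x = (\<Sum>j = - int ((k - 1) div 2)..int ((k - 1) div 2).
                 c j * exp (\<i> * of_real (pi / T * of_int j * x)))}"

text \<open>The norm of \<open>L\<^sup>\<infinity>(-1,1)\<close>. The essential supremum is an extended real; it is finite
  whenever \<open>g\<close> is continuous on \<open>[-1,1]\<close>.\<close>

definition Linf_norm :: "(real \<Rightarrow> complex) \<Rightarrow> real"
where
  "Linf_norm g = real_of_ereal (esssup (lebesgue_on {-1<..<1}) (\<lambda>x. ereal (cmod (g x))))"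

definition best_approx_error :: "(real \<Rightarrow> complex) \<Rightarrow> (real \<Rightarrow> complex) set \<Rightarrow> real"
where
  "best_approx_error f H = (INF r\<in>H. Linf_norm (\<lambda>x. f x - r x))"

lemma Linf_norm_nonneg: "0 \<le> Linf_norm g"
proof -
  let ?M = "lebesgue_on {-1<..<1::real}"
  have "esssup ?M (\<lambda>x. 0::ereal) \<le> esssup ?M (\<lambda>x. ereal (cmod (g x)))"
    by (rule esssup_mono) auto
  moreover have "esssup ?M (\<lambda>x. 0::ereal) = 0"
    by (rule esssup_const) (simp add: emeasure_restrict_space)
  ultimately show ?thesis
    by (simp add: Linf_norm_def real_of_ereal_pos)
qed

lemma best_approx_error_mem:
  assumes "f \<in> H" shows "best_approx_error f H = 0"
proof (rule antisym)
  have "Linf_norm (\<lambda>x. f x - f x) = 0"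
    by (simp add: Linf_norm_def zero_ereal_def[symmetric] esssup_const emeasure_restrict_space)
  moreover have "best_approx_error f H \<le> Linf_norm (\<lambda>x. f x - f x)"
    unfolding best_approx_error_def
    by (rule cINF_lower[OF _ assms]) (auto intro!: bdd_belowI[of _ 0] Linf_norm_nonneg)
  ultimately show "best_approx_error f H \<le> 0" by simp
  show "0 \<le> best_approx_error f H"
    unfolding best_approx_error_def using assms
    by (intro cINF_greatest) (auto intro: Linf_norm_nonneg)
qed

text \<open>The sum in the inverse theorem must include the constants \<open>\<H>\<^sub>1\<close>: if it starts at
  \<open>k = 3\<close>, its right-hand side vanishes on \<open>\<H>\<^sub>3\<close> and the estimate fails for every \<open>T\<close>,
  every \<open>n\<close> and every constant.\<close>

lemma inverse_estimate_fails_from_3: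
  fixes T C :: real and n :: nat
  assumes "T > 1" "n \<ge> 1"
  shows "\<exists>f. continuous_on {-1..1} f \<and>
    \<not> weighted_modulus (\<lambda>x. sqrt (1 - x\<^sup>2)) f (1 / real (2 * n + 1))
        \<le> C / real n * (\<Sum>k | odd k \<and> 3 \<le> k \<and> k \<le> 2 * n + 1.
                          best_approx_error f (trig_space T k))"
proof -
  define f :: "real \<Rightarrow> complex" where "f = (\<lambda>x. exp (\<i> * of_real (pi / T * x)))"
  define h where "h = 1 / (2 * real (2 * n + 1))"
  have mem: "f \<in> trig_space T k" if "3 \<le> k" for k
  proof -
    have "1 \<le> int ((k - 1) div 2)" using that by linarith
    then have "f x = (\<Sum>j = - int ((k - 1) div 2)..int ((k - 1) div 2).
        (if j = 1 then 1 else 0) * exp (\<i> * of_real (pi / T * of_int j * x)))" for x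
      by (subst sum.mono_neutral_right[of _ "{1}"]) (auto simp: f_def)
    then show ?thesis
      unfolding trig_space_def mem_Collect_eq
      by (intro exI[of _ "\<lambda>j. if j = 1 then 1 else 0"]) blast
  qed
  have sum0: "(\<Sum>k | odd k \<and> 3 \<le> k \<and> k \<le> 2 * n + 1. best_approx_error f (trig_space T k)) = 0"
    by (rule sum.neutral) (auto intro: best_approx_error_mem mem)
  have h: "0 < h" "h \<le> 1" "h < 1 / real (2 * n + 1)"
    using assms by (auto simp: h_def divide_simps)
  have norm_f: "cmod (f x) = 1" for x by (simp add: f_def)
  let ?S = "{cmod (f (x + t) - f (x - t)) | x t. x + t \<in> {-1..1} \<and> x - t \<in> {-1..1} \<and> 0 \<le> t \<and>
               t < sqrt (1 - x\<^sup>2) * (1 / real (2 * n + 1))}"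
  have le2: "cmod (f a - f b) \<le> 2" for a b
    using norm_triangle_ineq4[of "f a" "f b"] by (simp add: norm_f)
  have "bdd_above ?S"
    by (rule bdd_aboveI[of _ 2]) (use le2 in blast)
  moreover have "cmod (f (0 + h) - f (0 - h)) \<in> ?S"
    unfolding mem_Collect_eq
    by (intro exI[of _ 0] exI[of _ h]) (use h in \<open>simp del: of_nat_add of_nat_mult\<close>)
  ultimately have "cmod (f (0 + h) - f (0 - h)) \<le> Sup ?S"
    by (rule cSup_upper[rotated])
  moreover have "f h - f (- h) = 2 * \<i> * of_real (sin (pi / T * h))"
    by (simp add: f_def exp_Euler[symmetric] complex_eq_iff Re_exp Im_exp)
  moreover have "sin (pi / T * h) > 0"
  proof (rule sin_gt_zero)
    show "0 < pi / T * h" using assms h by simp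
    have "h / T < 1" using assms h by simp
    then have "pi * (h / T) < pi * 1" by (intro mult_strict_left_mono) auto
    then show "pi / T * h < pi" by simp
  qed
  ultimately have "0 < weighted_modulus (\<lambda>x. sqrt (1 - x\<^sup>2)) f (1 / real (2 * n + 1))"
    unfolding weighted_modulus_def by (auto simp: norm_mult)
  moreover have "continuous_on {-1..1} f"
    unfolding f_def by (intro continuous_intros)
  ultimately show ?thesis using sum0 by (intro exI[of _ f]) auto
qed

end

theory Submission
  imports Defs "HOL-Complex_Analysis.Conformal_Mappings"
begin

text \<open>
  The estimate follows the classical scheme of inverse theorems: a Bernstein inequality for the
  approximating spaces, and summation over approximants whose degrees grow geometrically.

  \<^bold>\<open>Bernstein inequality.\<close> Put \<open>\<alpha> = \<pi> / (2 T) < \<pi> / 2\<close> and substitute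
  \<open>sin (\<alpha> x) = sin \<alpha> sin t\<close>, which maps the line of all real \<open>t\<close> onto
  \<open>[-1, 1]\<close>. Then \<open>exp (\<i> \<pi> x / T) = (w + \<i> sin \<alpha> sin t)\<^sup>2\<close> with
  \<open>w = sqrt (1 - (sin \<alpha> sin t)\<^sup>2) \<ge> cos \<alpha> > 0\<close>, so an element of degree \<open>m\<close> of the
  exponential space becomes \<open>A + w B\<close>, where \<open>A\<close> is an even and \<open>B\<close> an odd trigonometric
  polynomial in \<open>t\<close> of degree \<open>O(m)\<close>. Since \<open>w\<close> is even, \<open>A\<close> and \<open>w B\<close> are the even
  and odd parts of a bounded function, hence they are bounded by the same constant. The ordinary
  Bernstein inequality for \<open>A\<close> and \<open>B\<close>, together with the Lipschitz continuity of \<open>w\<close>,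
  bounds the increments in \<open>t\<close> (lemma \<open>half_trig_lipschitz\<close>). Finally \<open>t\<close> is a Lipschitz
  function of \<open>arcsin x\<close>; this uses \<open>2 \<alpha> < \<pi>\<close>, that is \<open>T > 1\<close>
  (lemma \<open>edge_angle_le_arcsin\<close>). Altogether
  \<open>|r x - r y| \<le> C m M |arcsin x - arcsin y|\<close> if \<open>|r| \<le> M\<close> on \<open>[-1, 1]\<close>
  (lemma \<open>trig_space_lipschitz\<close>).

  \<^bold>\<open>Weighted steps.\<close> A step \<open>0 \<le> h \<le> \<delta> sqrt (1 - x\<^sup>2)\<close> moves \<open>x - h\<close> to
  \<open>x + h\<close> by at most \<open>8 \<delta>\<close> in the metric \<open>|arcsin x - arcsin y|\<close>
  (lemma \<open>arcsin_diff_le_of_weighted_step\<close>).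

  \<^bold>\<open>Summation.\<close> Let \<open>e m\<close> be slightly larger than the best approximation error of degree
  \<open>m\<close>, and \<open>r\<close> an approximant of degree \<open>n\<close> with error at most \<open>e n\<close>. Comparing \<open>r\<close>
  with an approximant of degree \<open>n div 2\<close>, and so on recursively, bounds the Lipschitz constant
  of \<open>r\<close> in the arcsine metric by a multiple of \<open>e 0 + \<dots> + e n\<close>
  (lemma \<open>approximant_lipschitz\<close>). With \<open>\<delta> \<approx> 1 / n\<close> and \<open>n e n \<le> e 0 + \<dots> + e n\<close> the
  theorem follows from \<open>f = r + (f - r)\<close>.
\<close>

section \<open>Bernstein's inequality for trigonometric polynomials\<close>

text \<open>Trigonometric polynomials of degree at most \<open>d\<close>, written as
  \<open>exp (- \<i> d t) p (exp (\<i> t))\<close> with an algebraic polynomial \<open>p\<close> of degree at most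
  \<open>2 d\<close>, so that complex analysis applies to \<open>p\<close> on the unit circle.\<close>

definition trig_poly :: "nat \<Rightarrow> (real \<Rightarrow> complex) \<Rightarrow> bool" where
  "trig_poly d R \<longleftrightarrow>
     (\<exists>p :: complex poly. degree p \<le> 2 * d \<and>
        (\<forall>t. R t = cis (- (real d * t)) * poly p (cis t)))"

lemma trig_poly_mono:
  assumes "trig_poly d R" "d \<le> e"
  shows "trig_poly e R"
proof -
  obtain p where p: "degree p \<le> 2 * d" "\<And>t. R t = cis (- (real d * t)) * poly p (cis t)"
    using assms(1) unfolding trig_poly_def by blast
  have "degree (p * monom 1 (e - d)) \<le> 2 * e"
    using degree_mult_le[of p "monom 1 (e - d)"] degree_monom_le[of "1::complex" "e - d"] p(1) assms(2)
    by linarith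
  moreover have "R t = cis (- (real e * t)) * poly (p * monom 1 (e - d)) (cis t)" for t
  proof -
    obtain k where "e = d + k" using assms(2) le_Suc_ex by blast
    then have "cis (- (real d * t)) = cis (- (real e * t)) * cis t ^ (e - d)"
      by (simp add: Complex.DeMoivre cis_mult algebra_simps)
    then show ?thesis by (simp add: p(2) poly_monom)
  qed
  ultimately show ?thesis unfolding trig_poly_def by blast
qed

lemma trig_poly_const: "trig_poly d (\<lambda>t. c)"
proof -
  have "trig_poly 0 (\<lambda>t. c)"
    unfolding trig_poly_def by (intro exI[of _ "[:c:]"]) auto
  then show ?thesis by (rule trig_poly_mono) simp
qed

lemma trig_poly_add:
  assumes "trig_poly d R" "trig_poly d S"
  shows "trig_poly d (\<lambda>t. R t + S t)"
proof -
  obtain p where p: "degree p \<le> 2 * d" "\<And>t. R t = cis (- (real d * t)) * poly p (cis t)"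
    using assms(1) unfolding trig_poly_def by blast
  obtain q where q: "degree q \<le> 2 * d" "\<And>t. S t = cis (- (real d * t)) * poly q (cis t)"
    using assms(2) unfolding trig_poly_def by blast
  show ?thesis
    unfolding trig_poly_def
    by (intro exI[of _ "p + q"] conjI allI degree_add_le p(1) q(1)) (simp add: p q distrib_left)
qed

lemma trig_poly_mult:
  assumes "trig_poly d R" "trig_poly e S"
  shows "trig_poly (d + e) (\<lambda>t. R t * S t)"
proof -
  obtain p where p: "degree p \<le> 2 * d" "\<And>t. R t = cis (- (real d * t)) * poly p (cis t)"
    using assms(1) unfolding trig_poly_def by blast
  obtain q where q: "degree q \<le> 2 * e" "\<And>t. S t = cis (- (real e * t)) * poly q (cis t)"
    using assms(2) unfolding trig_poly_def by blast
  have "degree (p * q) \<le> 2 * (d + e)"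
    using p(1) q(1) by (intro order_trans[OF degree_mult_le]) simp
  moreover have "R t * S t = cis (- (real (d + e) * t)) * poly (p * q) (cis t)" for t
  proof -
    have "cis (- (real (d + e) * t)) = cis (- (real d * t)) * cis (- (real e * t))"
      by (simp add: cis_mult algebra_simps)
    then show ?thesis by (simp add: p q)
  qed
  ultimately show ?thesis unfolding trig_poly_def by blast
qed

lemma trig_poly_sin: "trig_poly 1 (\<lambda>t. of_real (sin t))"
  unfolding trig_poly_def
proof (intro exI[of _ "[:\<i>/2, 0, -\<i>/2:]"] conjI allI)
  show "complex_of_real (sin t) = cis (- (real 1 * t)) * poly [:\<i>/2, 0, -\<i>/2:] (cis t)" for t
  proof -
    have "cis (- t) * (cis t * cis t) = cis t" by (simp add: cis_mult)
    then have "cis (- (real 1 * t)) * poly [:\<i>/2, 0, -\<i>/2:] (cis t) = \<i>/2 * (cis (- t) - cis t)"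
      by (simp add: algebra_simps)
    also have "\<dots> = of_real (sin t)" by (simp add: complex_eq_iff)
    finally show ?thesis by simp
  qed
qed simp

lemma poly_bound_on_disc:
  assumes "\<And>z. cmod z = 1 \<Longrightarrow> cmod (poly p z) \<le> M" "cmod z \<le> 1"
  shows "cmod (poly p z) \<le> M"
proof (rule maximum_modulus_frontier[where S = "cball 0 1" and f = "poly p"])
  show "poly p holomorphic_on interior (cball 0 1)"
    by (intro holomorphic_intros)
  show "continuous_on (closure (cball 0 1)) (poly p)"
    by (intro continuous_intros)
qed (use assms in auto)

text \<open>The maximum principle in the disc for the reversed polynomial
  \<open>w\<^sup>D p (1 / w)\<close>.\<close>

lemma poly_growth_outside_disc:
  assumes M: "\<And>z. cmod z = 1 \<Longrightarrow> cmod (poly p z) \<le> M"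
    and deg: "degree p \<le> D" and z: "cmod z \<ge> 1"
  shows "cmod (poly p z) \<le> M * cmod z ^ D"
proof -
  define q where "q = reflect_poly p * monom 1 (D - degree p)"
  have q: "poly q w = w ^ D * poly p (inverse w)" if "w \<noteq> 0" for w
    using that deg
    by (simp add: q_def poly_reflect_poly_nz poly_monom power_add[symmetric] mult.assoc mult.commute)
  have "z \<noteq> 0" using z by auto
  have "cmod (poly q (inverse z)) \<le> M"
  proof (rule poly_bound_on_disc)
    show "cmod (poly q w) \<le> M" if "cmod w = 1" for w
    proof -
      have "w \<noteq> 0" using that by auto
      then show ?thesis using M[of "inverse w"] that by (simp add: q norm_mult norm_power norm_inverse)
    qed
    show "cmod (inverse z) \<le> 1" using z by (simp add: norm_inverse inverse_le_1_iff)
  qed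
  moreover have "poly q (inverse z) = inverse z ^ D * poly p z"
    using \<open>z \<noteq> 0\<close> by (simp add: q)
  ultimately have "cmod (poly p z) / cmod z ^ D \<le> M"
    by (simp add: norm_mult norm_power norm_inverse divide_inverse power_inverse mult.commute)
  then show ?thesis using z \<open>z \<noteq> 0\<close> by (simp add: divide_simps)
qed

text \<open>Cauchy's inequality on a circle of radius \<open>1 / d\<close>: it stays in the disc of radius
  \<open>1 + 1 / d\<close>, where \<open>p\<close> is bounded by \<open>(1 + 1 / d) ^ (2 d) M \<le> 9 M\<close>.\<close>

lemma poly_deriv_bound_on_circle:
  assumes M: "\<And>z. cmod z = 1 \<Longrightarrow> cmod (poly p z) \<le> M"
    and deg: "degree p \<le> 2 * d" and d: "d \<ge> 1" and \<zeta>: "cmod \<zeta> = 1"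
  shows "cmod (poly (pderiv p) \<zeta>) \<le> 9 * real d * M"
proof -
  have M0: "0 \<le> M" using order_trans[OF norm_ge_zero M[of 1]] by simp
  have "(1 + 1 / real d) ^ d \<le> exp 1"
    using exp_ge_one_plus_x_over_n_power_n[of d 1] d by simp
  then have "(1 + 1 / real d) ^ d \<le> 3" using exp_le by linarith
  then have "((1 + 1 / real d) ^ d)\<^sup>2 \<le> 3\<^sup>2" by (intro power_mono) auto
  then have e9: "(1 + 1 / real d) ^ (2 * d) \<le> 9" by (simp add: power_mult mult.commute[of 2])
  have "cmod ((deriv ^^ 1) (poly p) \<zeta>) \<le> fact 1 * (9 * M) / (1 / real d) ^ 1"
  proof (rule Cauchy_inequality)
    show "poly p holomorphic_on ball \<zeta> (1 / real d)" by (intro holomorphic_intros)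
    show "continuous_on (cball \<zeta> (1 / real d)) (poly p)" by (intro continuous_intros)
    show "0 < 1 / real d" using d by simp
    show "cmod (poly p x) \<le> 9 * M" if x: "cmod (\<zeta> - x) = 1 / real d" for x
    proof (cases "cmod x \<le> 1")
      case True
      then show ?thesis using poly_bound_on_disc[OF M, of x] M0 by linarith
    next
      case False
      have "cmod x \<le> cmod \<zeta> + cmod (\<zeta> - x)"
        using norm_triangle_ineq4[of \<zeta> "\<zeta> - x"] by simp
      then have "cmod x ^ (2 * d) \<le> (1 + 1 / real d) ^ (2 * d)"
        using x \<zeta> by (intro power_mono) auto
      then have "M * cmod x ^ (2 * d) \<le> M * 9"
        using e9 M0 by (intro mult_left_mono) auto
      moreover have "cmod (poly p x) \<le> M * cmod x ^ (2 * d)"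
        using False by (intro poly_growth_outside_disc[OF M deg]) auto
      ultimately show ?thesis by linarith
    qed
  qed
  moreover have "deriv (poly p) \<zeta> = poly (pderiv p) \<zeta>"
    by (rule DERIV_imp_deriv[OF poly_DERIV])
  ultimately show ?thesis by (simp add: mult_ac)
qed

text \<open>Bernstein's inequality in integrated form. The sharp constant in place of \<open>10\<close> would be
  \<open>1\<close>; only the linear growth in \<open>d\<close> matters here.\<close>

lemma trig_poly_lipschitz:
  assumes R: "trig_poly d R" and d: "d \<ge> 1" and M: "\<And>t. cmod (R t) \<le> M"
  shows "cmod (R t - R u) \<le> 10 * real d * M * \<bar>t - u\<bar>"
proof -
  obtain p where deg: "degree p \<le> 2 * d" and p: "\<And>t. R t = cis (- (real d * t)) * poly p (cis t)"
    using R unfolding trig_poly_def by blast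
  have pM: "cmod (poly p z) \<le> M" if "cmod z = 1" for z
  proof -
    have "z \<noteq> 0" using that by auto
    then have "z = cis (Arg z)" using that by (simp add: cis_Arg sgn_div_norm)
    then show ?thesis using M[of "Arg z"] by (simp add: p norm_mult)
  qed
  \<comment> \<open>The entire extension of \<open>R\<close>, whose derivative is bounded along the real axis.\<close>
  define F where "F = (\<lambda>z. exp (- (of_nat d * \<i> * z)) * poly p (exp (\<i> * z)))"
  define F' where "F' = (\<lambda>z. - (of_nat d * \<i>) * exp (- (of_nat d * \<i> * z)) * poly p (exp (\<i> * z))
      + exp (- (of_nat d * \<i> * z)) * (poly (pderiv p) (exp (\<i> * z)) * (\<i> * exp (\<i> * z))))"
  have FR: "F (of_real x) = R x" for x
    by (simp add: F_def p cis_conv_exp mult_ac)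
  have "cmod (F (of_real t) - F (of_real u)) \<le> (10 * real d * M) * cmod (of_real t - of_real u)"
  proof (rule field_differentiable_bound[where S = "\<real>" and f' = F'])
    show "convex (\<real> :: complex set)" by (rule convex_Reals)
    show "(F has_field_derivative F' z) (at z within \<real>)" for z
    proof -
      have "((\<lambda>z. poly p (exp (\<i> * z))) has_field_derivative
          poly (pderiv p) (exp (\<i> * z)) * (\<i> * exp (\<i> * z))) (at z within \<real>)"
        by (rule DERIV_chain2[OF poly_DERIV]) (auto intro!: derivative_eq_intros)
      moreover have "((\<lambda>z. exp (- (of_nat d * \<i> * z))) has_field_derivative
          - (of_nat d * \<i>) * exp (- (of_nat d * \<i> * z))) (at z within \<real>)"
        by (auto intro!: derivative_eq_intros)
      ultimately show ?thesis
        unfolding F_def F'_def by (auto dest: DERIV_mult simp: mult_ac)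
    qed
    show "cmod (F' z) \<le> 10 * real d * M" if z: "z \<in> \<real>" for z
    proof -
      obtain x where x: "z = of_real x" using z by (rule Reals_cases)
      have c: "exp (\<i> * z) = cis x" "exp (- (of_nat d * \<i> * z)) = cis (- (real d * x))"
        by (simp_all add: x cis_conv_exp mult_ac)
      have "cmod (F' z) \<le> real d * cmod (poly p (cis x)) + cmod (poly (pderiv p) (cis x))"
        unfolding F'_def c by (rule order_trans[OF norm_triangle_ineq]) (simp add: norm_mult)
      moreover have "real d * cmod (poly p (cis x)) \<le> real d * M"
        by (intro mult_left_mono pM) auto
      ultimately show ?thesis
        using poly_deriv_bound_on_circle[OF pM deg d, of "cis x"] by simp
    qed
  qed auto
  then show ?thesis by (simp add: FR flip: of_real_diff)
qed

section \<open>Exponentials on a proper subinterval of their period\<close>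

text \<open>With \<open>s = sin \<alpha>\<close> this is \<open>cos (\<alpha> x)\<close> when \<open>sin (\<alpha> x) = s sin t\<close> and
  \<open>\<alpha> x\<close> lies in \<open>[- \<pi> / 2, \<pi> / 2]\<close>.\<close>

definition ell_root :: "real \<Rightarrow> real \<Rightarrow> real" where
  "ell_root s t = sqrt (1 - (s * sin t)\<^sup>2)"

text \<open>Functions \<open>A + w B\<close>, where \<open>w\<close> is \<open>ell_root s\<close>, and \<open>A\<close> and \<open>B\<close> are an
  even and an odd trigonometric polynomial of degree at most \<open>d\<close>. As \<open>w\<^sup>2\<close> is an even
  trigonometric polynomial of degree 2, such functions are closed under products, the degree bound
  increasing by 2.\<close>

definition half_trig :: "real \<Rightarrow> nat \<Rightarrow> (real \<Rightarrow> complex) \<Rightarrow> bool" where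
  "half_trig s d G \<longleftrightarrow>
     (\<exists>A B. trig_poly d A \<and> trig_poly d B \<and> (\<forall>t. A (- t) = A t) \<and> (\<forall>t. B (- t) = - B t) \<and>
        (\<forall>t. G t = A t + of_real (ell_root s t) * B t))"

lemma sin_scaled_square_le:
  assumes "0 \<le> s"
  shows "(s * sin t)\<^sup>2 \<le> (s::real)\<^sup>2"
proof -
  have "(sin t)\<^sup>2 \<le> 1" using sin_cos_squared_add[of t] zero_le_power2[of "cos t"] by linarith
  then show ?thesis using mult_left_mono[of "(sin t)\<^sup>2" 1 "s\<^sup>2"] by (simp add: power_mult_distrib)
qed

lemma ell_root_bounds:
  assumes "0 \<le> s" "s < 1"
  shows "sqrt (1 - s\<^sup>2) \<le> ell_root s t" "ell_root s t \<le> 1" "(ell_root s t)\<^sup>2 = 1 - (s * sin t)\<^sup>2"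
proof -
  have "s\<^sup>2 < 1" using assms by (simp add: power_less_one_iff abs_square_less_1)
  then show "sqrt (1 - s\<^sup>2) \<le> ell_root s t" "ell_root s t \<le> 1" "(ell_root s t)\<^sup>2 = 1 - (s * sin t)\<^sup>2"
    using sin_scaled_square_le[OF assms(1), of t] by (auto simp: ell_root_def)
qed

lemma ell_root_lipschitz:
  assumes s: "0 \<le> s" "s < 1"
  shows "\<bar>ell_root s t - ell_root s u\<bar> \<le> \<bar>t - u\<bar> / sqrt (1 - s\<^sup>2)"
proof -
  define k where "k = sqrt (1 - s\<^sup>2)"
  have "s\<^sup>2 < 1" using s by (simp add: power_less_one_iff abs_square_less_1)
  then have k: "k > 0" by (simp add: k_def)
  note b = ell_root_bounds[OF s]
  have "\<bar>ell_root s t - ell_root s u\<bar> * (2 * k) \<le> \<bar>ell_root s t - ell_root s u\<bar> * (ell_root s t + ell_root s u)"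
    using b(1)[of t] b(1)[of u] by (intro mult_left_mono) (auto simp: k_def)
  also have "\<dots> = \<bar>(ell_root s t)\<^sup>2 - (ell_root s u)\<^sup>2\<bar>"
  proof -
    have "0 \<le> ell_root s t + ell_root s u" using b(1)[of t] b(1)[of u] k k_def by linarith
    then show ?thesis by (simp add: power2_eq_square square_diff_square_factored abs_mult)
  qed
  also have "\<dots> = s\<^sup>2 * (\<bar>sin t + sin u\<bar> * \<bar>sin t - sin u\<bar>)"
  proof -
    have "(ell_root s t)\<^sup>2 - (ell_root s u)\<^sup>2 = - (s\<^sup>2 * ((sin t + sin u) * (sin t - sin u)))"
      unfolding b(3) by (simp add: power2_eq_square algebra_simps)
    then show ?thesis by (simp add: abs_mult)
  qed
  also have "\<dots> \<le> 1 * (2 * \<bar>t - u\<bar>)"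
  proof (intro mult_mono)
    show "\<bar>sin t + sin u\<bar> \<le> 2"
      using abs_sin_le_one[of t] abs_sin_le_one[of u] abs_triangle_ineq[of "sin t" "sin u"] by linarith
    have "norm (sin t - sin u) \<le> 1 * norm (t - u)"
      by (rule field_differentiable_bound[where S = UNIV and f' = cos])
         (auto intro!: derivative_eq_intros)
    then show "\<bar>sin t - sin u\<bar> \<le> \<bar>t - u\<bar>" by simp
  qed (use \<open>s\<^sup>2 < 1\<close> in auto)
  finally have "\<bar>ell_root s t - ell_root s u\<bar> * k \<le> \<bar>t - u\<bar>" by simp
  then show ?thesis using k by (simp add: k_def[symmetric] pos_le_divide_eq)
qed

lemma half_trig_const: "half_trig s d (\<lambda>t. c)"
  unfolding half_trig_def
  by (rule exI[of _ "\<lambda>t. c"], rule exI[of _ "\<lambda>t. 0"]) (simp add: trig_poly_const)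

lemma half_trig_mono:
  assumes "half_trig s d G" "d \<le> e" shows "half_trig s e G"
  using assms trig_poly_mono unfolding half_trig_def by blast

lemma half_trig_add:
  assumes "half_trig s d G" "half_trig s d H"
  shows "half_trig s d (\<lambda>t. G t + H t)"
proof -
  obtain A B where 1: "trig_poly d A" "trig_poly d B" "\<And>t. A (- t) = A t" "\<And>t. B (- t) = - B t"
      "\<And>t. G t = A t + of_real (ell_root s t) * B t"
    using assms(1) unfolding half_trig_def by blast
  obtain A' B' where 2: "trig_poly d A'" "trig_poly d B'" "\<And>t. A' (- t) = A' t" "\<And>t. B' (- t) = - B' t"
      "\<And>t. H t = A' t + of_real (ell_root s t) * B' t"
    using assms(2) unfolding half_trig_def by blast
  show ?thesis unfolding half_trig_def
    by (rule exI[of _ "\<lambda>t. A t + A' t"], rule exI[of _ "\<lambda>t. B t + B' t"])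
       (auto simp: 1(3-5) 2(3-5) algebra_simps intro!: trig_poly_add 1 2)
qed

lemma half_trig_scale:
  assumes "half_trig s d G"
  shows "half_trig s d (\<lambda>t. c * G t)"
proof -
  obtain A B where 1: "trig_poly d A" "trig_poly d B" "\<And>t. A (- t) = A t" "\<And>t. B (- t) = - B t"
      "\<And>t. G t = A t + of_real (ell_root s t) * B t"
    using assms unfolding half_trig_def by blast
  have "trig_poly d (\<lambda>t. c * A t)" "trig_poly d (\<lambda>t. c * B t)"
    using trig_poly_mult[OF trig_poly_const[of 0 c] 1(1)] trig_poly_mult[OF trig_poly_const[of 0 c] 1(2)]
    by simp_all
  then show ?thesis unfolding half_trig_def
    by (intro exI[of _ "\<lambda>t. c * A t"] exI[of _ "\<lambda>t. c * B t"]) (simp add: 1(3-5) algebra_simps)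
qed

lemma half_trig_sum:
  assumes "\<And>j. j \<in> I \<Longrightarrow> half_trig s d (G j)"
  shows "half_trig s d (\<lambda>t. \<Sum>j\<in>I. G j t)"
  using assms by (induction I rule: infinite_finite_induct) (auto simp: half_trig_const intro!: half_trig_add)

lemma half_trig_mult:
  assumes s: "0 \<le> s" "s < 1" and "half_trig s d G" "half_trig s e H"
  shows "half_trig s (d + e + 2) (\<lambda>t. G t * H t)"
proof -
  obtain A B where 1: "trig_poly d A" "trig_poly d B" "\<And>t. A (- t) = A t" "\<And>t. B (- t) = - B t"
      "\<And>t. G t = A t + of_real (ell_root s t) * B t"
    using assms(3) unfolding half_trig_def by blast
  obtain A' B' where 2: "trig_poly e A'" "trig_poly e B'" "\<And>t. A' (- t) = A' t" "\<And>t. B' (- t) = - B' t"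
      "\<And>t. H t = A' t + of_real (ell_root s t) * B' t"
    using assms(4) unfolding half_trig_def by blast
  define v where "v = (\<lambda>t. 1 + (- (of_real s)\<^sup>2) * (complex_of_real (sin t) * complex_of_real (sin t)))"
  have "trig_poly (0 + (1 + 1)) (\<lambda>t. (- (of_real s)\<^sup>2) * (complex_of_real (sin t) * complex_of_real (sin t)))"
    by (intro trig_poly_mult trig_poly_const trig_poly_sin)
  then have v: "trig_poly 2 v"
    unfolding v_def by (intro trig_poly_add trig_poly_const) (simp add: numeral_2_eq_2)
  have w2: "complex_of_real (ell_root s t) * complex_of_real (ell_root s t) = v t" for t
  proof -
    have "complex_of_real (ell_root s t) * complex_of_real (ell_root s t) = of_real ((ell_root s t)\<^sup>2)"
      by (simp add: power2_eq_square)
    then show ?thesis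
      unfolding ell_root_bounds(3)[OF s] by (simp add: v_def power2_eq_square algebra_simps)
  qed
  have "G t * H t = (A t * A' t + v t * (B t * B' t)) + of_real (ell_root s t) * (A t * B' t + B t * A' t)" for t
    unfolding 1(5) 2(5) w2[symmetric] by (simp add: algebra_simps)
  moreover have "trig_poly (d + e + 2) (\<lambda>t. A t * A' t + v t * (B t * B' t))"
  proof (rule trig_poly_add)
    show "trig_poly (d + e + 2) (\<lambda>t. A t * A' t)"
      by (rule trig_poly_mono[OF trig_poly_mult[OF 1(1) 2(1)]]) simp
    show "trig_poly (d + e + 2) (\<lambda>t. v t * (B t * B' t))"
      by (rule trig_poly_mono[OF trig_poly_mult[OF v trig_poly_mult[OF 1(2) 2(2)]]]) simp
  qed
  moreover have "trig_poly (d + e + 2) (\<lambda>t. A t * B' t + B t * A' t)"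
  proof (rule trig_poly_add)
    show "trig_poly (d + e + 2) (\<lambda>t. A t * B' t)"
      by (rule trig_poly_mono[OF trig_poly_mult[OF 1(1) 2(2)]]) simp
    show "trig_poly (d + e + 2) (\<lambda>t. B t * A' t)"
      by (rule trig_poly_mono[OF trig_poly_mult[OF 1(2) 2(1)]]) simp
  qed
  ultimately show ?thesis unfolding half_trig_def
    by (intro exI[of _ "\<lambda>t. A t * A' t + v t * (B t * B' t)"] exI[of _ "\<lambda>t. A t * B' t + B t * A' t"])
       (auto simp: 1(3,4) 2(3,4) v_def)
qed

lemma half_trig_power:
  assumes s: "0 \<le> s" "s < 1" and "half_trig s 2 G"
  shows "half_trig s (4 * j) (\<lambda>t. G t ^ j)"
proof (induction j)
  case (Suc j)
  have "2 + 4 * j + 2 = 4 * Suc j" by simp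
  then show ?case
    using half_trig_mult[OF s assms(3) Suc] by (simp only: power_Suc)
qed (simp add: half_trig_const)

text \<open>The parity of \<open>A\<close> and \<open>B\<close> makes a bound for \<open>G\<close> carry over to \<open>A\<close> and
  \<open>w B\<close> separately.\<close>

lemma half_trig_lipschitz:
  assumes s: "0 \<le> s" "s < 1" and G: "half_trig s d G" and d: "d \<ge> 1" and M: "\<And>t. cmod (G t) \<le> M"
  shows "cmod (G t - G u) \<le> 21 * real d * M / (1 - s\<^sup>2) * \<bar>t - u\<bar>"
proof -
  obtain A B where AB: "trig_poly d A" "trig_poly d B" "\<And>t. A (- t) = A t" "\<And>t. B (- t) = - B t"
      and GAB: "\<And>t. G t = A t + of_real (ell_root s t) * B t"
    using G unfolding half_trig_def by blast
  define k where "k = sqrt (1 - s\<^sup>2)"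
  have s2: "s\<^sup>2 < 1" using s by (simp add: power_less_one_iff abs_square_less_1)
  then have k: "0 < k" "k \<le> 1" "k\<^sup>2 = 1 - s\<^sup>2" by (auto simp: k_def)
  have M0: "0 \<le> M" using M[of 0] norm_ge_zero[of "G 0"] by linarith
  note b = ell_root_bounds[OF s, folded k_def]
  have even_w: "ell_root s (- t) = ell_root s t" for t by (simp add: ell_root_def)
  have boundA: "cmod (A t) \<le> M" for t
  proof -
    have "2 * A t = G t + G (- t)" by (simp add: GAB AB even_w)
    then have "cmod (2 * A t) \<le> M + M" using norm_triangle_mono[OF M M] by metis
    then show ?thesis by (simp add: norm_mult)
  qed
  have boundB: "cmod (B t) \<le> M / k" for t
  proof -
    have "2 * (of_real (ell_root s t) * B t) = G t - G (- t)" by (simp add: GAB AB even_w)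
    then have "cmod (2 * (of_real (ell_root s t) * B t)) \<le> M + M"
      using norm_triangle_ineq4[of "G t" "G (- t)"] M[of t] M[of "- t"] by (metis add_mono order_trans)
    then have "ell_root s t * cmod (B t) \<le> M" using b(1)[of t] k(1) by (simp add: norm_mult)
    moreover have "k * cmod (B t) \<le> ell_root s t * cmod (B t)" using b(1) by (intro mult_right_mono) auto
    ultimately have "k * cmod (B t) \<le> M" by linarith
    then show ?thesis using k(1) by (simp add: pos_le_divide_eq mult.commute)
  qed
  let ?\<Delta> = "\<bar>t - u\<bar>"
  have "G t - G u = (A t - A u) + (of_real (ell_root s t) * (B t - B u) + of_real (ell_root s t - ell_root s u) * B u)"
    by (simp add: GAB algebra_simps)
  then have "cmod (G t - G u) \<le> cmod (A t - A u) + (cmod (of_real (ell_root s t) * (B t - B u))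
      + cmod (of_real (ell_root s t - ell_root s u) * B u))"
    by (metis add_left_mono norm_triangle_ineq order_trans)
  also have "\<dots> \<le> 10 * real d * M * ?\<Delta> + (1 * (10 * real d * (M / k) * ?\<Delta>) + ?\<Delta> / k * (M / k))"
    unfolding norm_mult norm_of_real
  proof (intro add_mono mult_mono)
    show "cmod (A t - A u) \<le> 10 * real d * M * ?\<Delta>" by (rule trig_poly_lipschitz[OF AB(1) d boundA])
    show "cmod (B t - B u) \<le> 10 * real d * (M / k) * ?\<Delta>" by (rule trig_poly_lipschitz[OF AB(2) d boundB])
    show "\<bar>ell_root s t\<bar> \<le> 1" using b(1,2)[of t] k(1) by linarith
    show "\<bar>ell_root s t - ell_root s u\<bar> \<le> ?\<Delta> / k" unfolding k_def by (rule ell_root_lipschitz[OF s])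
  qed (use boundB k in auto)
  also have "\<dots> \<le> 10 * (real d * M / k\<^sup>2 * ?\<Delta>) + (10 * (real d * M / k\<^sup>2 * ?\<Delta>) + real d * M / k\<^sup>2 * ?\<Delta>)"
  proof -
    have kk: "k\<^sup>2 \<le> k" "k\<^sup>2 \<le> 1" "0 < k\<^sup>2" using k(1,2) by (auto simp: power2_eq_square mult_le_one)
    let ?Q = "real d * M / k\<^sup>2 * ?\<Delta>"
    have "real d * M / 1 * ?\<Delta> \<le> ?Q"
      using kk M0 by (intro mult_right_mono divide_left_mono) auto
    then have 1: "10 * real d * M * ?\<Delta> \<le> 10 * ?Q" by simp
    have "real d * M / k * ?\<Delta> \<le> ?Q"
      using kk k M0 by (intro mult_right_mono divide_left_mono) auto
    then have 2: "1 * (10 * real d * (M / k) * ?\<Delta>) \<le> 10 * ?Q" by simp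
    have "1 * M / k\<^sup>2 * ?\<Delta> \<le> ?Q"
      using kk d M0 by (intro mult_right_mono divide_right_mono) auto
    then have 3: "?\<Delta> / k * (M / k) \<le> ?Q" by (simp add: power2_eq_square mult_ac)
    show ?thesis using 1 2 3 by linarith
  qed
  also have "\<dots> = 21 * real d * M / (1 - s\<^sup>2) * ?\<Delta>" unfolding k(3) by simp
  finally show ?thesis .
qed

lemma mult_cos_le_sin:
  assumes "0 \<le> v" "v < pi / 2"
  shows "v * cos v \<le> sin v"
proof -
  have "v \<le> tan v" using abs_tan_ge[of v] assms tan_pos_pi2_le[of v] by auto
  moreover have "cos v > 0" using assms by (intro cos_gt_zero_pi) auto
  ultimately show ?thesis by (simp add: tan_def pos_le_divide_eq)
qed

lemma mult_cos_square_le_sin_double: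
  assumes "0 \<le> v" "v < pi / 2"
  shows "2 * v * (cos v)\<^sup>2 \<le> sin (2 * v)"
proof -
  have "cos v > 0" using assms by (intro cos_gt_zero_pi) auto
  then have "2 * cos v * (v * cos v) \<le> 2 * cos v * sin v"
    using mult_cos_le_sin[OF assms] by (intro mult_left_mono) auto
  then show ?thesis unfolding sin_double by (simp add: power2_eq_square mult_ac)
qed

text \<open>The angle \<open>t\<close> in \<open>[- \<pi> / 2, \<pi> / 2]\<close> with
  \<open>sin (\<alpha> x) = sin \<alpha> sin t\<close>, for \<open>x\<close> in \<open>[-1, 1]\<close>.\<close>

definition edge_angle :: "real \<Rightarrow> real \<Rightarrow> real" where
  "edge_angle \<alpha> x = arcsin (sin (\<alpha> * x) / sin \<alpha>)"

context
  fixes \<alpha> :: real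
  assumes \<alpha>: "0 < \<alpha>" "\<alpha> < pi / 2"
begin

lemma sin_cos_pos: "0 < sin \<alpha>" "sin \<alpha> < 1" "0 < cos \<alpha>" "1 - (sin \<alpha>)\<^sup>2 = (cos \<alpha>)\<^sup>2"
proof -
  show c: "0 < cos \<alpha>" using \<alpha> by (intro cos_gt_zero_pi) auto
  show s: "0 < sin \<alpha>" using \<alpha> by (intro sin_gt_zero2) auto
  show *: "1 - (sin \<alpha>)\<^sup>2 = (cos \<alpha>)\<^sup>2" by (simp add: cos_squared_eq)
  show "sin \<alpha> < 1" using sin_monotone_2pi[of \<alpha> "pi/2"] \<alpha> by simp
qed

lemma edge_sine_bounds:
  assumes "x \<in> {-1..1}"
  shows "- 1 \<le> sin (\<alpha> * x) / sin \<alpha>" "sin (\<alpha> * x) / sin \<alpha> \<le> 1"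
proof -
  define z where "z = \<alpha> * x"
  have "\<bar>z\<bar> \<le> \<alpha>"
    using assms \<alpha> mult_left_mono[of "\<bar>x\<bar>" 1 \<alpha>] by (auto simp: z_def abs_mult)
  then have "- \<alpha> \<le> z" "z \<le> \<alpha>" by auto
  then have "sin (- \<alpha>) \<le> sin z" "sin z \<le> sin \<alpha>"
    using \<alpha> by (intro sin_monotone_2pi_le; linarith)+
  then show "- 1 \<le> sin (\<alpha> * x) / sin \<alpha>" "sin (\<alpha> * x) / sin \<alpha> \<le> 1"
    using sin_cos_pos by (auto simp: z_def divide_simps)
qed

text \<open>The right-hand side equals \<open>sin (\<alpha> (1 + x)) sin (\<alpha> (1 - x))\<close>, with both arguments in
  \<open>[0, 2 \<alpha>]\<close>, where the sine is bounded below by a multiple of its argument because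
  \<open>2 \<alpha> < \<pi>\<close>.\<close>

lemma edge_weight_bound:
  assumes x: "- 1 < x" "x < 1"
  shows "(\<alpha> * (cos \<alpha>)\<^sup>2)\<^sup>2 * (1 - x\<^sup>2) \<le> (sin \<alpha>)\<^sup>2 - (sin (\<alpha> * x))\<^sup>2"
proof -
  have *: "2 * \<alpha> * ((1 + y) / 2) * (cos \<alpha>)\<^sup>2 \<le> sin (\<alpha> * (1 + y))" if y: "-1 < y" "y < 1" for y
  proof -
    define v where "v = \<alpha> * ((1 + y) / 2)"
    have v: "0 \<le> v" "v \<le> \<alpha>"
      using \<alpha> y mult_left_mono[of "(1+y)/2" 1 \<alpha>] by (auto simp: v_def)
    have "cos \<alpha> \<le> cos v" using v \<alpha> by (intro cos_monotone_0_pi_le) auto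
    then have "(cos \<alpha>)\<^sup>2 \<le> (cos v)\<^sup>2" using sin_cos_pos by (intro power_mono) auto
    then have "2 * v * (cos \<alpha>)\<^sup>2 \<le> 2 * v * (cos v)\<^sup>2" using v by (intro mult_left_mono) auto
    also have "\<dots> \<le> sin (2 * v)" using v \<alpha> by (intro mult_cos_square_le_sin_double) auto
    finally show ?thesis by (simp add: v_def)
  qed
  have "(\<alpha> * (cos \<alpha>)\<^sup>2)\<^sup>2 * (1 - x\<^sup>2) =
      (2 * \<alpha> * ((1 + x) / 2) * (cos \<alpha>)\<^sup>2) * (2 * \<alpha> * ((1 + - x) / 2) * (cos \<alpha>)\<^sup>2)"
    by (simp add: power2_eq_square algebra_simps)
  also have "\<dots> \<le> sin (\<alpha> * (1 + x)) * sin (\<alpha> * (1 + - x))"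
  proof (intro mult_mono *)
    show "0 \<le> sin (\<alpha> * (1 + x))" using *[OF x] \<alpha> x by (intro order_trans[OF _ *]) auto
    show "0 \<le> 2 * \<alpha> * ((1 + - x) / 2) * (cos \<alpha>)\<^sup>2" using \<alpha> x by auto
  qed (use x in auto)
  also have "\<dots> = (sin \<alpha>)\<^sup>2 - (sin (\<alpha> * x))\<^sup>2"
    by (simp add: distrib_left sin_add sin_diff cos_squared_eq algebra_simps flip: power2_eq_square)
  finally show ?thesis .
qed

text \<open>The derivative of \<open>edge_angle \<alpha>\<close> at \<open>x\<close> is at most
  \<open>1 / ((cos \<alpha>)\<^sup>2 sqrt (1 - x\<^sup>2))\<close>.\<close>

lemma edge_angle_le_arcsin:
  assumes "- 1 \<le> x" "x \<le> y" "y \<le> 1"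
  shows "\<bar>edge_angle \<alpha> y - edge_angle \<alpha> x\<bar> \<le> (arcsin y - arcsin x) / (cos \<alpha>)\<^sup>2"
proof -
  define g where "g = (\<lambda>x. sin (\<alpha> * x) / sin \<alpha>)"
  note sc = sin_cos_pos
  have cont: "continuous_on {x..y} (\<lambda>x. edge_angle \<alpha> x)"
    unfolding edge_angle_def using edge_sine_bounds assms sc
    by (intro continuous_intros) auto
  have cont': "continuous_on {x..y} arcsin"
    using assms by (intro continuous_intros) auto
  have der: "\<exists>D. DERIV (edge_angle \<alpha>) z :> D \<and> 0 \<le> D \<and> D \<le> inverse (sqrt (1 - z\<^sup>2)) / (cos \<alpha>)\<^sup>2
      \<and> DERIV arcsin z :> inverse (sqrt (1 - z\<^sup>2))" if z: "x < z" "z < y" for z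
  proof -
    have z1: "- 1 < z" "z < 1" using z assms by auto
    have z2: "0 < 1 - z\<^sup>2" using z1 by (simp add: abs_square_less_1 abs_less_iff)
    have w: "(\<alpha> * (cos \<alpha>)\<^sup>2 / sin \<alpha>)\<^sup>2 * (1 - z\<^sup>2) \<le> 1 - (g z)\<^sup>2"
      using edge_weight_bound[OF z1] sc by (simp add: g_def power_divide divide_simps)
    have pos: "0 < \<alpha> * (cos \<alpha>)\<^sup>2 / sin \<alpha>" using \<alpha> sc by simp
    then have "0 < (\<alpha> * (cos \<alpha>)\<^sup>2 / sin \<alpha>)\<^sup>2 * (1 - z\<^sup>2)" using z2 by (intro mult_pos_pos zero_less_power)
    then have g0: "0 < 1 - (g z)\<^sup>2" using w by linarith
    then have g1: "- 1 < g z" "g z < 1" by (auto simp: abs_square_less_1 abs_less_iff)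
    have s: "\<alpha> * (cos \<alpha>)\<^sup>2 / sin \<alpha> * sqrt (1 - z\<^sup>2) \<le> sqrt (1 - (g z)\<^sup>2)"
      using real_sqrt_le_mono[OF w] pos by (simp only: real_sqrt_mult real_sqrt_abs abs_of_pos)
    define D where "D = inverse (sqrt (1 - (g z)\<^sup>2)) * (cos (\<alpha> * z) * \<alpha> / sin \<alpha>)"
    have "DERIV (\<lambda>x. arcsin (g x)) z :> D"
      unfolding D_def
    proof (rule DERIV_chain2[OF DERIV_arcsin])
      show "DERIV g z :> cos (\<alpha> * z) * \<alpha> / sin \<alpha>"
        unfolding g_def using sc by (auto intro!: derivative_eq_intros)
    qed (use g1 in auto)
    then have 1: "DERIV (edge_angle \<alpha>) z :> D" by (simp add: edge_angle_def[abs_def] g_def)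
    have "\<bar>\<alpha> * z\<bar> \<le> \<alpha>"
      using z1 \<alpha> mult_left_mono[of "\<bar>z\<bar>" 1 \<alpha>] by (auto simp: abs_mult)
    then have "\<bar>\<alpha> * z\<bar> < pi / 2" using \<alpha>(2) by (rule le_less_trans)
    then have c: "0 < cos (\<alpha> * z)" by (intro cos_gt_zero_pi) auto
    have 2: "0 \<le> D" using c g0 \<alpha> sc by (simp add: D_def)
    have "D \<le> inverse (\<alpha> * (cos \<alpha>)\<^sup>2 / sin \<alpha> * sqrt (1 - z\<^sup>2)) * (1 * \<alpha> / sin \<alpha>)"
      unfolding D_def
    proof (intro mult_mono le_imp_inverse_le s divide_right_mono mult_right_mono)
      show "0 < \<alpha> * (cos \<alpha>)\<^sup>2 / sin \<alpha> * sqrt (1 - z\<^sup>2)" using pos z2 by (intro mult_pos_pos) auto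
      then show "0 \<le> inverse (\<alpha> * (cos \<alpha>)\<^sup>2 / sin \<alpha> * sqrt (1 - z\<^sup>2))"
        by (intro less_imp_le positive_imp_inverse_positive)
    qed (use \<alpha> sc c in auto)
    also have "\<dots> = inverse (sqrt (1 - z\<^sup>2)) / (cos \<alpha>)\<^sup>2" using \<alpha> sc by (simp add: field_simps)
    finally show ?thesis using 1 2 DERIV_arcsin[OF z1] by blast
  qed
  have "edge_angle \<alpha> x \<le> edge_angle \<alpha> y"
    by (rule DERIV_nonneg_imp_increasing_open[OF assms(2) _ cont]) (use der in blast)
  moreover have "arcsin x / (cos \<alpha>)\<^sup>2 - edge_angle \<alpha> x \<le> arcsin y / (cos \<alpha>)\<^sup>2 - edge_angle \<alpha> y"
  proof (rule DERIV_nonneg_imp_increasing_open[OF assms(2)])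
    fix z assume "x < z" "z < y"
    from der[OF this] obtain D where D: "DERIV (edge_angle \<alpha>) z :> D" "D \<le> inverse (sqrt (1 - z\<^sup>2)) / (cos \<alpha>)\<^sup>2"
      "DERIV arcsin z :> inverse (sqrt (1 - z\<^sup>2))" by blast
    then show "\<exists>E. DERIV (\<lambda>z. arcsin z / (cos \<alpha>)\<^sup>2 - edge_angle \<alpha> z) z :> E \<and> 0 \<le> E"
      by (intro exI[of _ "inverse (sqrt (1 - z\<^sup>2)) / (cos \<alpha>)\<^sup>2 - D"])
         (auto intro!: DERIV_diff DERIV_cdivide)
  next
    show "continuous_on {x..y} (\<lambda>z. arcsin z / (cos \<alpha>)\<^sup>2 - edge_angle \<alpha> z)"
      using sc by (intro continuous_intros cont cont') auto
  qed
  ultimately show ?thesis by (simp add: diff_divide_distrib)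
qed

lemma exponential_pullback:
  assumes "sin (\<alpha> * x) = sin \<alpha> * sin t" "x \<in> {-1..1}"
  shows "exp (\<i> * of_real (2 * \<alpha> * x)) =
    of_real (1 - 2 * (sin \<alpha> * sin t)\<^sup>2) + of_real (ell_root (sin \<alpha>) t) * (2 * \<i> * of_real (sin \<alpha> * sin t))"
proof -
  have "\<bar>\<alpha> * x\<bar> \<le> \<alpha>"
    using assms \<alpha> mult_left_mono[of "\<bar>x\<bar>" 1 \<alpha>] by (auto simp: abs_mult)
  then have "\<bar>\<alpha> * x\<bar> < pi / 2" using \<alpha>(2) by (rule le_less_trans)
  then have "0 < cos (\<alpha> * x)" by (intro cos_gt_zero_pi) auto
  then have c: "ell_root (sin \<alpha>) t = cos (\<alpha> * x)"
    unfolding ell_root_def assms(1)[symmetric] by (simp flip: cos_squared_eq)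
  have "2 * \<alpha> * x = 2 * (\<alpha> * x)" by simp
  then show ?thesis
    unfolding c assms(1)[symmetric]
    by (simp only: flip: cis_conv_exp)
       (simp add: complex_eq_iff cos_double_sin sin_double)
qed

text \<open>The sign \<open>\<sigma>\<close> covers the exponentials of negative frequency.\<close>

lemma half_trig_exponential:
  assumes X: "\<And>t. sin (\<alpha> * X t) = sin \<alpha> * sin t" "\<And>t. X t \<in> {-1..1}"
    and "\<sigma> = 1 \<or> \<sigma> = -1"
  shows "half_trig (sin \<alpha>) 2 (\<lambda>t. exp (\<i> * of_real (2 * \<alpha> * (\<sigma> * X t))))"
proof -
  let ?s = "complex_of_real (sin \<alpha>)"
  let ?A = "\<lambda>t. 1 + (- 2 * ?s\<^sup>2) * (complex_of_real (sin t) * complex_of_real (sin t))"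
  let ?B = "\<lambda>t. (2 * \<i> * of_real \<sigma> * ?s) * complex_of_real (sin t)"
  have "trig_poly (0 + (1 + 1)) (\<lambda>t. (- 2 * ?s\<^sup>2) * (complex_of_real (sin t) * complex_of_real (sin t)))"
    by (intro trig_poly_mult trig_poly_const trig_poly_sin)
  then have A: "trig_poly 2 ?A" by (intro trig_poly_add trig_poly_const) (simp add: numeral_2_eq_2)
  have "trig_poly (0 + 1) ?B" by (intro trig_poly_mult trig_poly_const trig_poly_sin)
  then have B: "trig_poly 2 ?B" by (rule trig_poly_mono) simp
  have "exp (\<i> * of_real (2 * \<alpha> * (\<sigma> * X t))) = ?A t + of_real (ell_root (sin \<alpha>) t) * ?B t" for t
  proof -
    have 1: "sin (\<alpha> * (\<sigma> * X t)) = sin \<alpha> * sin (\<sigma> * t)" "\<sigma> * X t \<in> {-1..1}"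
      using assms(3) X[of t] by auto
    have 2: "ell_root (sin \<alpha>) (\<sigma> * t) = ell_root (sin \<alpha>) t" "sin (\<sigma> * t) = \<sigma> * sin t" "\<sigma> * \<sigma> = 1"
      using assms(3) by (auto simp: ell_root_def)
    have 3: "(sin \<alpha> * (\<sigma> * sin t))\<^sup>2 = (sin \<alpha>)\<^sup>2 * (sin t * sin t)"
      using assms(3) by (auto simp: power2_eq_square)
    show ?thesis
      unfolding exponential_pullback[OF 1] 2(1,2) 3 by (simp add: mult_ac)
  qed
  then show ?thesis unfolding half_trig_def
    using A B by (intro exI[of _ ?A] exI[of _ ?B]) auto
qed

text \<open>The Bernstein inequality for the exponential space, with \<open>2 \<alpha>\<close> in place of
  \<open>\<pi> / T\<close>.\<close>

lemma trig_sum_lipschitz: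
  assumes m: "m \<ge> 1"
    and r: "\<And>x. r x = (\<Sum>j = - int m..int m. c j * exp (\<i> * of_real (2 * \<alpha> * of_int j * x)))"
    and M: "\<And>x. x \<in> {-1..1} \<Longrightarrow> cmod (r x) \<le> M"
    and xy: "- 1 \<le> x" "x \<le> y" "y \<le> 1"
  shows "cmod (r y - r x) \<le> 84 / (cos \<alpha>) ^ 4 * real m * M * (arcsin y - arcsin x)"
proof -
  note sc = sin_cos_pos
  \<comment> \<open>The substitution is defined for all real \<open>t\<close>, with values in \<open>[-1, 1]\<close>, so that the
    bound for \<open>r\<close> on \<open>[-1, 1]\<close> becomes one for \<open>r \<circ> X\<close> on the whole line.\<close>
  define X where "X = (\<lambda>t. arcsin (sin \<alpha> * sin t) / \<alpha>)"
  have b1: "\<bar>sin \<alpha> * sin t\<bar> \<le> sin \<alpha>" for t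
    using sc mult_left_mono[of "\<bar>sin t\<bar>" 1 "sin \<alpha>"] by (simp add: abs_mult)
  then have b: "- sin \<alpha> \<le> sin \<alpha> * sin t" "sin \<alpha> * sin t \<le> sin \<alpha>" for t
    by (simp_all add: abs_le_iff minus_le_iff)
  have "\<bar>sin \<alpha> * sin t\<bar> \<le> 1" for t by (rule order_trans[OF b1]) (use sc in simp)
  then have b2: "- 1 \<le> sin \<alpha> * sin t" "sin \<alpha> * sin t \<le> 1" for t
    by (simp_all only: abs_le_iff minus_le_iff)
  have X1: "sin (\<alpha> * X t) = sin \<alpha> * sin t" for t
    using b2[of t] \<alpha> by (simp add: X_def)
  have X2: "X t \<in> {-1..1}" for t
  proof -
    have "arcsin (sin \<alpha> * sin t) \<le> arcsin (sin \<alpha>)" "arcsin (sin (- \<alpha>)) \<le> arcsin (sin \<alpha> * sin t)"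
      using b[of t] b2[of t] sc by (intro arcsin_le_arcsin; simp)+
    moreover have "arcsin (sin \<alpha>) = \<alpha>" "arcsin (sin (- \<alpha>)) = - \<alpha>"
      using \<alpha> by (intro arcsin_sin; simp)+
    ultimately show ?thesis using \<alpha> by (simp add: X_def divide_simps)
  qed
  have X3: "X (edge_angle \<alpha> z) = z" if "z \<in> {-1..1}" for z
  proof -
    have "\<alpha> * \<bar>z\<bar> \<le> \<alpha> * 1" using that \<alpha> by (intro mult_left_mono) auto
    then have "\<bar>\<alpha> * z\<bar> \<le> \<alpha>" using \<alpha> by (simp add: abs_mult)
    then have "arcsin (sin (\<alpha> * z)) = \<alpha> * z" using \<alpha> by (intro arcsin_sin) auto
    then show ?thesis
      using edge_sine_bounds[OF that] sc \<alpha> by (simp add: X_def edge_angle_def)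
  qed
  have "half_trig (sin \<alpha>) (4 * m) (\<lambda>t. \<Sum>j = - int m..int m. c j * exp (\<i> * of_real (2 * \<alpha> * of_int j * X t)))"
  proof (rule half_trig_sum)
    fix j :: int assume j: "j \<in> {- int m..int m}"
    define \<sigma> :: real where "\<sigma> = (if j \<ge> 0 then 1 else -1)"
    define k where "k = nat \<bar>j\<bar>"
    have j': "of_int j = \<sigma> * real k" by (auto simp: \<sigma>_def k_def)
    have e: "exp (\<i> * of_real (2 * \<alpha> * of_int j * X t)) =
        exp (\<i> * of_real (2 * \<alpha> * (\<sigma> * X t))) ^ k" for t
      unfolding exp_of_nat_mult[symmetric] j' by (simp add: mult_ac)
    have "half_trig (sin \<alpha>) (4 * k) (\<lambda>t. exp (\<i> * of_real (2 * \<alpha> * of_int j * X t)))"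
      unfolding e using sc
      by (intro half_trig_power half_trig_exponential X1 X2) (auto simp: \<sigma>_def)
    then show "half_trig (sin \<alpha>) (4 * m) (\<lambda>t. c j * exp (\<i> * of_real (2 * \<alpha> * of_int j * X t)))"
      using j k_def by (intro half_trig_scale half_trig_mono[of _ "4 * k" _ "4 * m"]) auto
  qed
  then have half: "half_trig (sin \<alpha>) (4 * m) (\<lambda>t. r (X t))" by (simp add: r)
  define t where "t = edge_angle \<alpha> y"
  define u where "u = edge_angle \<alpha> x"
  have M0: "0 \<le> M" using order_trans[OF norm_ge_zero M[of 0]] by simp
  have "cmod (r (X t) - r (X u)) \<le> 21 * real (4 * m) * M / (1 - (sin \<alpha>)\<^sup>2) * \<bar>t - u\<bar>"
    using sc m by (intro half_trig_lipschitz half M X2) auto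
  also have "\<dots> \<le> 21 * real (4 * m) * M / (1 - (sin \<alpha>)\<^sup>2) * ((arcsin y - arcsin x) / (cos \<alpha>)\<^sup>2)"
    unfolding t_def u_def
    by (intro mult_left_mono edge_angle_le_arcsin xy) (use M0 sc in auto)
  also have "\<dots> = 84 / (cos \<alpha>) ^ 4 * real m * M * (arcsin y - arcsin x)"
    unfolding sc(4) by (simp add: power4_eq_xxxx power2_eq_square)
  finally show ?thesis using xy by (simp add: t_def u_def X3)
qed

end

section \<open>Distances in the arcsine metric\<close>

text \<open>With \<open>x - h = sin (u - v)\<close> and \<open>x + h = sin (u + v)\<close> the hypothesis reads
  \<open>(cos u sin v)\<^sup>2 \<le> \<delta>\<^sup>2 ((cos u)\<^sup>2 + (sin u sin v)\<^sup>2)\<close>. Since \<open>u \<plusminus> v\<close> lie in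
  \<open>[- \<pi> / 2, \<pi> / 2]\<close>, also \<open>sin v \<le> cos u\<close>, and so \<open>sin v = O(\<delta>)\<close>.\<close>

lemma arcsin_diff_le_of_weighted_step:
  assumes x: "x + h \<in> {-1..1}" "x - h \<in> {-1..1}" and h: "0 \<le> h" "h \<le> sqrt (1 - x\<^sup>2) * \<delta>"
    and \<delta>: "0 \<le> \<delta>"
  shows "arcsin (x + h) - arcsin (x - h) \<le> 8 * \<delta>"
proof -
  define a where "a = arcsin (x - h)"
  define b where "b = arcsin (x + h)"
  define u where "u = (a + b) / 2"
  define v where "v = (b - a) / 2"
  have ab: "- (pi / 2) \<le> a" "b \<le> pi / 2" "a \<le> b"
    using x h arcsin_lbound[of "x - h"] arcsin_ubound[of "x + h"] arcsin_le_arcsin[of "x - h" "x + h"]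
    by (auto simp: a_def b_def)
  have sab: "sin a = x - h" "sin b = x + h" using x by (auto simp: a_def b_def)
  have "a = u - v" "b = u + v" by (simp_all add: u_def v_def field_simps)
  then have xh: "x = sin u * cos v" "h = cos u * sin v"
    using sab by (auto simp: sin_add sin_diff)
  have uv: "0 \<le> v" "v \<le> pi / 2" "\<bar>u\<bar> \<le> pi / 2 - v"
    using ab by (auto simp: u_def v_def field_simps)
  have "sin v = cos (pi / 2 - v)" by (simp add: cos_diff)
  also have "\<dots> \<le> cos \<bar>u\<bar>" using uv by (intro cos_monotone_0_pi_le) auto
  finally have le: "sin v \<le> cos u" by simp
  have sv: "0 \<le> sin v" using uv by (intro sin_ge_zero) auto
  have "sin v \<le> 2 * \<delta>"
  proof (cases "cos u = 0")
    case True
    then show ?thesis using le sv \<delta> by simp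
  next
    case False
    then have cu: "0 < cos u" using le sv by linarith
    have "1 - x\<^sup>2 = (cos u)\<^sup>2 + (sin u)\<^sup>2 * (sin v)\<^sup>2"
      by (simp add: xh power_mult_distrib cos_squared_eq algebra_simps)
    also have "\<dots> \<le> (cos u)\<^sup>2 + 1 * (cos u)\<^sup>2"
    proof (intro add_left_mono mult_mono power_mono le sv)
      show "(sin u)\<^sup>2 \<le> 1" using sin_cos_squared_add[of u] zero_le_power2[of "cos u"] by linarith
    qed auto
    also have "\<dots> \<le> (2 * cos u)\<^sup>2" by (simp add: power_mult_distrib)
    finally have "sqrt (1 - x\<^sup>2) \<le> 2 * cos u"
      using cu by (intro real_le_lsqrt) auto
    then have "h \<le> 2 * cos u * \<delta>" using h \<delta> by (meson mult_right_mono order_trans)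
    then have "cos u * sin v \<le> cos u * (2 * \<delta>)" by (simp add: xh mult_ac)
    then show ?thesis using cu by simp
  qed
  moreover have "v \<le> 2 * sin v"
  proof -
    have "cos (pi / 4) \<le> cos (v / 2)" using uv by (intro cos_monotone_0_pi_le) auto
    then have "(cos (pi / 4))\<^sup>2 \<le> (cos (v / 2))\<^sup>2" by (intro power_mono) (auto simp: cos_45)
    then have "1 / 2 \<le> (cos (v / 2))\<^sup>2" by (simp add: cos_45 power_divide)
    then have "v * (1 / 2) \<le> v * (cos (v / 2))\<^sup>2" using uv by (intro mult_left_mono) auto
    moreover have "2 * (v / 2) * (cos (v / 2))\<^sup>2 \<le> sin (2 * (v / 2))"
      by (rule mult_cos_square_le_sin_double) (use uv pi_gt_zero in linarith)+
    ultimately show ?thesis by simp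
  qed
  ultimately have "2 * v \<le> 8 * \<delta>" by linarith
  then show ?thesis by (simp add: v_def a_def b_def)
qed

section \<open>The inverse estimate from a Bernstein inequality\<close>

text \<open>An abstract form of the summation step, for nested spaces \<open>V n\<close> with a Bernstein
  inequality relative to \<open>\<rho>\<close>. An approximant from \<open>V n\<close> is compared with one from \<open>V k\<close>,
  where \<open>k = n div 2\<close>: the difference costs \<open>2 C n e k\<close>, and this is paid for by the terms
  \<open>e m\<close> with \<open>k div 2 < m \<le> k\<close>, each of which is at least \<open>e k\<close>. That is why the sum
  in the claim stops at \<open>n div 2\<close> rather than at \<open>n\<close>.\<close>

lemma approximant_lipschitz:
  fixes V :: "nat \<Rightarrow> ('a \<Rightarrow> complex) set" and \<rho> :: "'a \<Rightarrow> 'a \<Rightarrow> real" and e :: "nat \<Rightarrow> real"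
  assumes mono: "\<And>m n. m \<le> n \<Longrightarrow> V m \<subseteq> V n"
    and diff: "\<And>n r q. r \<in> V n \<Longrightarrow> q \<in> V n \<Longrightarrow> (\<lambda>x. r x - q x) \<in> V n"
    and const: "\<And>r x y. r \<in> V 0 \<Longrightarrow> r x = r y"
    and bern: "\<And>n r M x y. n \<ge> 1 \<Longrightarrow> r \<in> V n \<Longrightarrow> (\<And>z. z \<in> S \<Longrightarrow> cmod (r z) \<le> M) \<Longrightarrow>
        x \<in> S \<Longrightarrow> y \<in> S \<Longrightarrow> cmod (r x - r y) \<le> C * real n * M * \<rho> x y"
    and C: "0 \<le> C" and \<rho>: "\<And>x y. 0 \<le> \<rho> x y"
    and e: "\<And>n. 0 \<le> e n" "\<And>m n. m \<le> n \<Longrightarrow> e n \<le> e m"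
    and approx: "\<And>n. \<exists>r\<in>V n. \<forall>x\<in>S. cmod (f x - r x) \<le> e n"
  shows "\<exists>r\<in>V n. (\<forall>x\<in>S. cmod (f x - r x) \<le> e n) \<and>
    (\<forall>x\<in>S. \<forall>y\<in>S. cmod (r x - r y) \<le> 12 * C * (\<Sum>m\<le>n div 2. e m) * \<rho> x y)"
proof (induction n rule: less_induct)
  case (less n)
  have step: "cmod (r x - r y) \<le> cmod (q x - q y) + 2 * C * real n * e k * \<rho> x y"
    if n: "n \<ge> 1" and k: "k \<le> n" and r: "r \<in> V n" "\<forall>x\<in>S. cmod (f x - r x) \<le> e n"
      and q: "q \<in> V k" "\<forall>x\<in>S. cmod (f x - q x) \<le> e k" and xy: "x \<in> S" "y \<in> S" for r q k x y
  proof -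
    have "(\<lambda>z. r z - q z) \<in> V n" using diff r(1) q(1) mono[OF k] by blast
    moreover have "cmod (r z - q z) \<le> 2 * e k" if "z \<in> S" for z
    proof -
      have "r z - q z = (f z - q z) - (f z - r z)" by simp
      then have "cmod (r z - q z) \<le> cmod (f z - q z) + cmod (f z - r z)"
        by (metis norm_triangle_ineq4)
      then show ?thesis using r(2) q(2) that e(2)[OF k] by fastforce
    qed
    ultimately have "cmod ((r x - q x) - (r y - q y)) \<le> C * real n * (2 * e k) * \<rho> x y"
      using bern[OF n, of "\<lambda>z. r z - q z"] xy by blast
    moreover have "r x - r y = (q x - q y) + ((r x - q x) - (r y - q y))" by simp
    then have "cmod (r x - r y) \<le> cmod (q x - q y) + cmod ((r x - q x) - (r y - q y))"
      by (metis norm_triangle_ineq)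
    ultimately show ?thesis by (simp add: mult_ac)
  qed
  obtain r where r: "r \<in> V n" "\<forall>x\<in>S. cmod (f x - r x) \<le> e n" using approx by blast
  consider "n = 0" | "n = 1" | "n \<ge> 2" by linarith
  then show ?case
  proof cases
    case 1
    have "cmod (r x - r y) \<le> 12 * C * (\<Sum>m\<le>n div 2. e m) * \<rho> x y" for x y
    proof -
      have "cmod (r x - r y) = 0" using const[of r x y] r 1 by simp
      also have "0 \<le> 12 * C * (\<Sum>m\<le>n div 2. e m) * \<rho> x y"
        using C \<rho> e by (intro mult_nonneg_nonneg sum_nonneg) auto
      finally show ?thesis .
    qed
    then show ?thesis using r by blast
  next
    \<comment> \<open>Here \<open>n div 2\<close> and its half are both 0, so no terms are left to pay with; instead,
      elements of \<open>V 0\<close> have no increments.\<close>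
    case 2
    obtain q where q: "q \<in> V 0" "\<forall>x\<in>S. cmod (f x - q x) \<le> e 0" using approx by blast
    have "cmod (r x - r y) \<le> 12 * C * (\<Sum>m\<le>n div 2. e m) * \<rho> x y" if "x \<in> S" "y \<in> S" for x y
    proof -
      have "cmod (r x - r y) \<le> 2 * (C * e 0 * \<rho> x y)"
        using step[OF _ _ r q that] const[OF q(1), of x y] 2 by (simp add: mult_ac)
      also have "\<dots> \<le> 12 * (C * e 0 * \<rho> x y)"
        using C \<rho> e by (intro mult_right_mono) auto
      finally show ?thesis by (simp add: 2 mult_ac)
    qed
    then show ?thesis using r by blast
  next
    case 3
    define k where "k = n div 2"
    have k: "k < n" "1 \<le> k" "n \<le> 3 * k" using 3 by (auto simp: k_def)
    obtain q where q: "q \<in> V k" "\<forall>x\<in>S. cmod (f x - q x) \<le> e k"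
      and ql: "\<forall>x\<in>S. \<forall>y\<in>S. cmod (q x - q y) \<le> 12 * C * (\<Sum>m\<le>k div 2. e m) * \<rho> x y"
      using less[OF k(1)] by blast
    have "real n * e k \<le> 6 * (\<Sum>m\<in>{k div 2<..k}. e m)"
    proof -
      have "n \<le> 6 * (k - k div 2)" using k by linarith
      then have "real n * e k \<le> real (6 * (k - k div 2)) * e k"
        using e(1) by (intro mult_right_mono of_nat_mono) auto
      also have "\<dots> = 6 * (\<Sum>m\<in>{k div 2<..k}. e k)" by simp
      also have "\<dots> \<le> 6 * (\<Sum>m\<in>{k div 2<..k}. e m)"
        by (intro mult_left_mono sum_mono e(2)) auto
      finally show ?thesis .
    qed
    moreover have "(\<Sum>m\<le>k. e m) = (\<Sum>m\<le>k div 2. e m) + (\<Sum>m\<in>{k div 2<..k}. e m)"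
    proof -
      have "{..k} = {..k div 2} \<union> {k div 2<..k}" by auto
      then show ?thesis by (simp only:) (rule sum.union_disjoint, auto)
    qed
    ultimately have sum: "6 * (\<Sum>m\<le>k div 2. e m) + real n * e k \<le> 6 * (\<Sum>m\<le>k. e m)" by simp
    have "cmod (r x - r y) \<le> 12 * C * (\<Sum>m\<le>n div 2. e m) * \<rho> x y" if xy: "x \<in> S" "y \<in> S" for x y
    proof -
      have "cmod (r x - r y) \<le> cmod (q x - q y) + 2 * C * real n * e k * \<rho> x y"
        using step[OF _ _ r q xy] k by simp
      also have "\<dots> \<le> 12 * C * (\<Sum>m\<le>k div 2. e m) * \<rho> x y + 2 * C * real n * e k * \<rho> x y"
        using ql xy by simp
      also have "\<dots> = 2 * C * \<rho> x y * (6 * (\<Sum>m\<le>k div 2. e m) + real n * e k)"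
        by (simp add: algebra_simps)
      also have "\<dots> \<le> 2 * C * \<rho> x y * (6 * (\<Sum>m\<le>k. e m))"
        using C \<rho> sum by (intro mult_left_mono) auto
      finally show ?thesis by (simp add: k_def mult_ac)
    qed
    then show ?thesis using r by blast
  qed
qed

section \<open>Best approximation from the exponential spaces\<close>

text \<open>For continuous functions the essential supremum is a supremum: a strict excess would hold on
  a nonempty open set, which is not negligible. The endpoints follow by continuity.\<close>

lemma cmod_le_Linf_norm:
  assumes g: "continuous_on {-1..1} g" and x: "x \<in> {-1..1}"
  shows "cmod (g x) \<le> Linf_norm g"
proof -
  let ?M = "lebesgue_on {-1<..<1::real}"
  have cn: "continuous_on {-1..1} (\<lambda>x. cmod (g x))" using g by (intro continuous_intros)
  have "(\<lambda>x. cmod (g x)) \<in> borel_measurable ?M"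
    by (intro continuous_imp_measurable_on_sets_lebesgue continuous_on_subset[OF cn]) auto
  then have meas: "(\<lambda>x. ereal (cmod (g x))) \<in> borel_measurable ?M" by simp
  obtain b where b: "\<And>x. x \<in> {-1..1} \<Longrightarrow> cmod (g x) \<le> b"
  proof -
    have "compact ((\<lambda>x. cmod (g x)) ` {-1..1})" by (intro compact_continuous_image cn) auto
    then have "bounded ((\<lambda>x. cmod (g x)) ` {-1..1})" by (rule compact_imp_bounded)
    then obtain b where "\<forall>x\<in>{-1..1}. cmod (g x) \<le> b" by (auto simp: bounded_iff)
    then show ?thesis using that by blast
  qed
  define c where "c = esssup ?M (\<lambda>x. ereal (cmod (g x)))"
  have "c \<le> ereal b" unfolding c_def
    using b by (intro esssup_I meas AE_I2) (auto simp: space_restrict_space)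
  moreover have "0 \<le> c"
  proof -
    have "esssup ?M (\<lambda>x. 0::ereal) \<le> c" unfolding c_def by (rule esssup_mono) auto
    moreover have "esssup ?M (\<lambda>x. 0::ereal) = 0"
      by (rule esssup_const) (simp add: emeasure_restrict_space)
    ultimately show ?thesis by simp
  qed
  ultimately have c: "c = ereal (Linf_norm g)"
    unfolding Linf_norm_def c_def[symmetric] by (cases c) auto
  have interior: "cmod (g y) \<le> Linf_norm g" if "y \<in> {-1<..<1}" for y
  proof (rule ccontr)
    assume "\<not> ?thesis"
    define U where "U = {y \<in> {-1<..<1}. Linf_norm g < cmod (g y)}"
    have "open U"
    proof -
      have "U = {-1<..<1} \<inter> (\<lambda>y. cmod (g y)) -` {Linf_norm g<..}" by (auto simp: U_def)
      moreover have "open ({-1<..<1} \<inter> (\<lambda>y. cmod (g y)) -` {Linf_norm g<..})"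
        by (intro continuous_open_preimage continuous_on_subset[OF cn]) auto
      ultimately show ?thesis by simp
    qed
    have "emeasure ?M U = 0"
      using esssup_zero_measure[of ?M "\<lambda>x. ereal (cmod (g x))", folded c_def]
      by (simp add: c U_def space_restrict_space)
    moreover have "emeasure ?M U = emeasure lebesgue U"
      by (rule emeasure_restrict_space) (auto simp: U_def)
    ultimately have "emeasure lborel U = 0" using \<open>open U\<close> by simp
    then have "U \<in> null_sets lborel" using \<open>open U\<close> by (intro null_setsI) auto
    then have "negligible U" by (simp add: negligible_iff_null_sets null_sets_completionI)
    then have "U = {}" using \<open>open U\<close> open_not_negligible by blast
    then show False using \<open>\<not> cmod (g y) \<le> Linf_norm g\<close> that by (auto simp: U_def)
  qed
  have "{-1..1::real} = closure {-1<..<1}" by simp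
  then show ?thesis
    using continuous_le_on_closure[of "{-1<..<1::real}" "\<lambda>x. cmod (g x)" x "Linf_norm g"] cn x interior
    by auto
qed

lemma trig_space_mono:
  assumes "m \<le> n"
  shows "trig_space T (2 * m + 1) \<subseteq> trig_space T (2 * n + 1)"
proof
  fix r assume "r \<in> trig_space T (2 * m + 1)"
  then obtain c where c: "\<And>x. r x = (\<Sum>j = - int m..int m. c j * exp (\<i> * of_real (pi / T * of_int j * x)))"
    unfolding trig_space_def by auto
  have "r x = (\<Sum>j = - int n..int n. (if j \<in> {- int m..int m} then c j else 0) *
      exp (\<i> * of_real (pi / T * of_int j * x)))" for x
    unfolding c using assms by (intro sum.mono_neutral_cong_left) auto
  then show "r \<in> trig_space T (2 * n + 1)"
    unfolding trig_space_def mem_Collect_eq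
    by (intro exI[of _ "\<lambda>j. if j \<in> {- int m..int m} then c j else 0"]) simp
qed

lemma trig_space_diff:
  assumes "r \<in> trig_space T k" "q \<in> trig_space T k"
  shows "(\<lambda>x. r x - q x) \<in> trig_space T k"
proof -
  obtain c where c: "\<And>x. r x = (\<Sum>j = - int ((k - 1) div 2)..int ((k - 1) div 2).
      c j * exp (\<i> * of_real (pi / T * of_int j * x)))"
    using assms(1) unfolding trig_space_def by auto
  obtain d where d: "\<And>x. q x = (\<Sum>j = - int ((k - 1) div 2)..int ((k - 1) div 2).
      d j * exp (\<i> * of_real (pi / T * of_int j * x)))"
    using assms(2) unfolding trig_space_def by auto
  show ?thesis unfolding trig_space_def mem_Collect_eq c d
    by (intro exI[of _ "\<lambda>j. c j - d j"]) (simp add: sum_subtractf left_diff_distrib)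
qed

lemma trig_space_continuous: "r \<in> trig_space T k \<Longrightarrow> continuous_on S r"
proof -
  assume "r \<in> trig_space T k"
  then obtain c where c: "\<And>x. r x = (\<Sum>j = - int ((k - 1) div 2)..int ((k - 1) div 2).
      c j * exp (\<i> * of_real (pi / T * of_int j * x)))"
    unfolding trig_space_def by auto
  define \<omega> where "\<omega> = pi / T"
  have "r = (\<lambda>x. \<Sum>j = - int ((k - 1) div 2)..int ((k - 1) div 2). c j * exp (\<i> * of_real (\<omega> * of_int j * x)))"
    by (simp add: c \<omega>_def fun_eq_iff)
  then show ?thesis by (auto intro!: continuous_intros)
qed

lemma trig_space_nonempty: "trig_space T k \<noteq> {}"
  unfolding trig_space_def by auto

lemma bdd_below_Linf_norm: "bdd_below ((\<lambda>r. Linf_norm (\<lambda>x. f x - r x)) ` H)"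
  by (auto intro!: bdd_belowI[of _ 0] Linf_norm_nonneg)

lemma best_approx_error_antimono:
  assumes "G \<subseteq> H" "G \<noteq> {}"
  shows "best_approx_error f H \<le> best_approx_error f G"
  unfolding best_approx_error_def
  by (rule cINF_superset_mono[OF assms(2) bdd_below_Linf_norm assms(1)]) simp

lemma best_approx_error_nonneg:
  assumes "H \<noteq> {}" shows "0 \<le> best_approx_error f H"
  unfolding best_approx_error_def using assms by (intro cINF_greatest Linf_norm_nonneg)

text \<open>The margin \<open>\<epsilon>\<close> avoids the question whether the infimum is attained.\<close>

lemma near_best_approximant:
  assumes f: "continuous_on {-1..1} f" and \<epsilon>: "\<epsilon> > 0"
  shows "\<exists>r\<in>trig_space T k. \<forall>x\<in>{-1..1}. cmod (f x - r x) \<le> best_approx_error f (trig_space T k) + \<epsilon>"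
proof -
  have "(INF r\<in>trig_space T k. Linf_norm (\<lambda>x. f x - r x)) < best_approx_error f (trig_space T k) + \<epsilon>"
    using \<epsilon> by (simp add: best_approx_error_def)
  then obtain r where r: "r \<in> trig_space T k"
      "Linf_norm (\<lambda>x. f x - r x) < best_approx_error f (trig_space T k) + \<epsilon>"
    using cINF_less_iff[OF trig_space_nonempty bdd_below_Linf_norm] by blast
  have "cmod (f x - r x) \<le> Linf_norm (\<lambda>x. f x - r x)" if "x \<in> {-1..1}" for x
    using that f trig_space_continuous[OF r(1)] by (intro cmod_le_Linf_norm continuous_intros) auto
  then show ?thesis using r by (intro bexI[of _ r]) fastforce+
qed

lemma trig_space_lipschitz:
  assumes "T > 1" "n \<ge> 1" "r \<in> trig_space T (2 * n + 1)"
    and M: "\<And>z. z \<in> {-1..1} \<Longrightarrow> cmod (r z) \<le> M" and xy: "x \<in> {-1..1}" "y \<in> {-1..1}"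
  shows "cmod (r x - r y) \<le> 84 / cos (pi / (2 * T)) ^ 4 * real n * M * \<bar>arcsin x - arcsin y\<bar>"
proof -
  have \<alpha>: "0 < pi / (2 * T)" "pi / (2 * T) < pi / 2" using assms(1) by (auto simp: field_simps)
  obtain c where "\<And>x. r x = (\<Sum>j = - int n..int n. c j * exp (\<i> * of_real (pi / T * of_int j * x)))"
    using assms(3) unfolding trig_space_def by auto
  then have c: "\<And>x. r x = (\<Sum>j = - int n..int n. c j * exp (\<i> * of_real (2 * (pi / (2 * T)) * of_int j * x)))"
    by simp
  have *: "cmod (r b - r a) \<le> 84 / cos (pi / (2 * T)) ^ 4 * real n * M * \<bar>arcsin b - arcsin a\<bar>"
    if "a \<le> b" "a \<in> {-1..1}" "b \<in> {-1..1}" for a b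
  proof -
    have "arcsin a \<le> arcsin b" using that by (intro arcsin_le_arcsin) auto
    then show ?thesis
      using trig_sum_lipschitz[OF \<alpha> assms(2) c M, of a b] that by simp
  qed
  show ?thesis
    using *[of x y] *[of y x] xy
    by (cases "x \<le> y") (auto simp: norm_minus_commute abs_minus_commute)
qed

theorem theorem5p7:
  fixes T :: real
  assumes "T > 1"
  shows "\<exists>C :: real. C > 0 \<and>
    (\<forall>n :: nat. \<forall>f :: real \<Rightarrow> complex. n \<ge> 1 \<longrightarrow> continuous_on {-1..1} f \<longrightarrow>
       weighted_modulus (\<lambda>x. sqrt (1 - x\<^sup>2)) f (1 / real (2 * n + 1))
         \<le> C / real n * (\<Sum>k | odd k \<and> 1 \<le> k \<and> k \<le> 2 * n + 1.
                           best_approx_error f (trig_space T k)))"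
proof -
  define C where "C = 84 / cos (pi / (2 * T)) ^ 4"
  have C: "0 \<le> C" by (simp add: C_def)
  have "weighted_modulus (\<lambda>x. sqrt (1 - x\<^sup>2)) f (1 / real (2 * n + 1))
         \<le> (2 + 48 * C) / real n * (\<Sum>k | odd k \<and> 1 \<le> k \<and> k \<le> 2 * n + 1.
                           best_approx_error f (trig_space T k))"
    if n: "n \<ge> 1" and f: "continuous_on {-1..1} f" for n f
  proof -
    define E where "E = (\<lambda>m. best_approx_error f (trig_space T (2 * m + 1)))"
    have E0: "0 \<le> E m" for m unfolding E_def by (rule best_approx_error_nonneg[OF trig_space_nonempty])
    have E1: "E l \<le> E m" if "m \<le> l" for m l unfolding E_def
      by (intro best_approx_error_antimono trig_space_mono trig_space_nonempty that)
    have sumE: "(\<Sum>k | odd k \<and> 1 \<le> k \<and> k \<le> 2 * n + 1. best_approx_error f (trig_space T k)) = (\<Sum>m\<le>n. E m)"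
      by (rule sum.reindex_bij_witness[of _ "\<lambda>m. 2 * m + 1" "\<lambda>k. (k - 1) div 2"])
         (auto simp: E_def elim!: oddE)
    define \<delta> where "\<delta> = 1 / real (2 * n + 1)"
    have \<delta>: "0 \<le> \<delta>" "2 * \<delta> \<le> 1 / real n" using n by (auto simp: \<delta>_def field_simps)
    have main: "cmod (f (x + h) - f (x - h)) \<le> (2 + 48 * C) / real n * (\<Sum>m\<le>n. E m)"
      if xh: "x + h \<in> {-1..1}" "x - h \<in> {-1..1}" "0 \<le> h" "h < sqrt (1 - x\<^sup>2) * \<delta>" for x h
    proof (rule field_le_epsilon)
      fix \<epsilon>' :: real assume "0 < \<epsilon>'"
      define K where "K = (2 + 48 * C) / real n"
      have K: "0 < K" using C n by (simp add: K_def)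
      \<comment> \<open>Raising each of the \<open>n + 1\<close> errors by \<open>\<epsilon>\<close> changes the final bound by
        \<open>\<epsilon>'\<close>.\<close>
      define \<epsilon> where "\<epsilon> = \<epsilon>' / (K * real (n + 1))"
      have \<epsilon>: "0 < \<epsilon>" using K \<open>0 < \<epsilon>'\<close> by (simp add: \<epsilon>_def)
      define e where "e = (\<lambda>m. E m + \<epsilon>)"
      have e0: "0 \<le> e m" for m using E0[of m] \<epsilon> by (simp add: e_def)
      have e1: "e l \<le> e m" if "m \<le> l" for m l using E1[OF that] by (simp add: e_def)
      define \<rho> where "\<rho> = (\<lambda>x y. \<bar>arcsin x - arcsin y\<bar>)"
      have "\<exists>r\<in>trig_space T (2 * n + 1). (\<forall>x\<in>{-1..1}. cmod (f x - r x) \<le> e n) \<and>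
        (\<forall>x\<in>{-1..1}. \<forall>y\<in>{-1..1}. cmod (r x - r y) \<le> 12 * C * (\<Sum>m\<le>n div 2. e m) * \<rho> x y)"
      proof (rule approximant_lipschitz[where V = "\<lambda>n. trig_space T (2 * n + 1)"])
        show "\<exists>r\<in>trig_space T (2 * m + 1). \<forall>x\<in>{-1..1}. cmod (f x - r x) \<le> e m" for m
          unfolding e_def E_def by (rule near_best_approximant[OF f \<epsilon>])
        show "trig_space T (2 * m + 1) \<subseteq> trig_space T (2 * l + 1)" if "m \<le> l" for m l
          by (rule trig_space_mono[OF that])
        show "r x = r y" if "r \<in> trig_space T (2 * 0 + 1)" for r x y
          using that by (auto simp: trig_space_def)
        show "cmod (r x - r y) \<le> C * real m * M * \<rho> x y"
          if "1 \<le> m" "r \<in> trig_space T (2 * m + 1)" "\<And>z. z \<in> {-1..1} \<Longrightarrow> cmod (r z) \<le> M"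
            "x \<in> {-1..1}" "y \<in> {-1..1}" for m r M x y
          unfolding C_def \<rho>_def using assms that by (intro trig_space_lipschitz) auto
      qed (use C e0 e1 in \<open>auto simp: \<rho>_def trig_space_diff\<close>)
      then obtain r where r: "\<And>x. x \<in> {-1..1} \<Longrightarrow> cmod (f x - r x) \<le> e n"
        and rl: "\<And>x y. x \<in> {-1..1} \<Longrightarrow> y \<in> {-1..1} \<Longrightarrow> cmod (r x - r y) \<le> 12 * C * (\<Sum>m\<le>n div 2. e m) * \<rho> x y"
        by blast
      let ?S = "\<Sum>m\<le>n. e m"
      have S0: "0 \<le> ?S" by (intro sum_nonneg e0)
      have S1: "(\<Sum>m\<le>n div 2. e m) \<le> ?S" by (intro sum_mono2 e0) auto
      have S2: "e n \<le> 1 / real n * ?S"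
      proof -
        have "real n * e n \<le> (\<Sum>m\<le>n. e n)" using e0[of n] by (simp add: algebra_simps)
        also have "\<dots> \<le> ?S" by (intro sum_mono e1) auto
        finally show ?thesis using n by (simp add: field_simps)
      qed
      have \<rho>: "\<rho> (x + h) (x - h) \<le> 4 * (1 / real n)"
      proof -
        have "arcsin (x + h) - arcsin (x - h) \<le> 8 * \<delta>"
          using xh \<delta> by (intro arcsin_diff_le_of_weighted_step) auto
        moreover have "arcsin (x - h) \<le> arcsin (x + h)" using xh by (intro arcsin_le_arcsin) auto
        ultimately show ?thesis using \<delta>(2) by (simp add: \<rho>_def)
      qed
      have "f (x + h) - f (x - h) = (f (x + h) - r (x + h)) - (f (x - h) - r (x - h)) + (r (x + h) - r (x - h))"
        by simp
      then have "cmod (f (x + h) - f (x - h)) \<le> cmod (f (x + h) - r (x + h)) + cmod (f (x - h) - r (x - h))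
          + cmod (r (x + h) - r (x - h))"
        by (metis add_right_mono norm_triangle_ineq norm_triangle_ineq4 order_trans)
      also have "\<dots> \<le> 1 / real n * ?S + 1 / real n * ?S + 12 * C * ?S * (4 * (1 / real n))"
      proof (intro add_mono)
        show "cmod (f (x + h) - r (x + h)) \<le> 1 / real n * ?S" "cmod (f (x - h) - r (x - h)) \<le> 1 / real n * ?S"
          using r xh S2 by (meson order_trans)+
        have "cmod (r (x + h) - r (x - h)) \<le> 12 * C * (\<Sum>m\<le>n div 2. e m) * \<rho> (x + h) (x - h)"
          using rl xh by blast
        also have "\<dots> \<le> 12 * C * ?S * (4 * (1 / real n))"
          by (intro mult_mono S1 \<rho>) (use C S0 e0 in \<open>auto simp: \<rho>_def intro!: sum_nonneg\<close>)
        finally show "cmod (r (x + h) - r (x - h)) \<le> 12 * C * ?S * (4 * (1 / real n))" .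
      qed
      also have "\<dots> = K * ?S" using n by (simp add: K_def field_simps)
      also have "\<dots> = K * (\<Sum>m\<le>n. E m) + \<epsilon>'"
      proof -
        have "\<epsilon> * (K * real (n + 1)) = \<epsilon>'"
          unfolding \<epsilon>_def by (rule nonzero_eq_divide_eq[THEN iffD1, OF _ refl]) (use K in simp)
        then show ?thesis by (simp add: e_def sum.distrib distrib_left mult_ac)
      qed
      finally show "cmod (f (x + h) - f (x - h)) \<le> (2 + 48 * C) / real n * (\<Sum>m\<le>n. E m) + \<epsilon>'"
        by (simp add: K_def)
    qed
    show ?thesis
      unfolding sumE weighted_modulus_def \<delta>_def[symmetric]
    proof (rule cSup_least)
      show "{cmod (f (x + h) - f (x - h)) |x h. x + h \<in> {-1..1} \<and> x - h \<in> {-1..1} \<and> 0 \<le> h \<and>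
          h < sqrt (1 - x\<^sup>2) * \<delta>} \<noteq> {}"
      proof -
        have "0 < sqrt (1 - 0\<^sup>2) * \<delta>" by (simp add: \<delta>_def)
        then show ?thesis by (auto intro!: exI[of _ "0::real"])
      qed
    qed (use main in blast)
  qed
  moreover have "0 < 2 + 48 * C" using C by simp
  ultimately show ?thesis by blast
qed

end
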